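(* For $u,v,n\in\mathbb{N}$, let $C_3(u,v,n)$ be the number of partitions of $n$ into $u$ distinct parts congruent to $1$ modulo $3$ and $v$ distinct parts congruent to $2$ modulo $3$. Let $D_3(u,v,n)$ be the number of partitions $\lambda_1+\cdots+\lambda_s$ of $n$ into positive integers in two colours, ordinary and primed, such that only parts congruent to $\pm1\pmod 6$ may be primed, $1'$ is not a part, $u$ equals the number of ordinary parts congruent to $0$ or $1$ modulo $3$ plus twice the number of primed parts congruent to $5$ modulo $6$, $v$ equals the number of ordinary parts congruent to $0$ or $2$ modulo $3$ plus twice the number of primed parts congruent to $1$ modulo $6$, and for all $1\le i<s$: $$\lambda_i-\lambda_{i+1}\ge\begin{cases}4+\chi(\lambda_{i+1}) & \text{if }\lambda_i\equiv1,2,3,5\pmod 6\text{ and }\lambda_i\text{ is not primed},\\ 5+\chi(\lambda_{i+1}) & \text{if }\lambda_i\equiv 0,4\pmod 6,\\ 6+\chi(\lambda_{i+1}) & \text{if }\lambda_i\equiv1,5\pmod 6\text{ and }\lambda_i\text{ is primed},\end{cases}$$ where $\chi(\lambda_{i+1})=1$ if $\lambda_{i+1}$ is primed and $0$ otherwise. Then $C_3(u,v,n)=D_3(u,v,n)$ for all $u,v,n$. *)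

theory Defs
  imports Main
begin

text \<open>C_3(u,v,n): partitions of n into distinct parts, each congruent to 1 or 2 mod 3,
  with u parts congruent to 1 mod 3 and v parts congruent to 2 mod 3.
  A partition into distinct parts is identified with its (finite) set of parts.\<close>
definition C3 :: "nat \<Rightarrow> nat \<Rightarrow> nat \<Rightarrow> nat" where
  "C3 u v n = card {S :: nat set. finite S \<and> (\<forall>x\<in>S. 0 < x \<and> (x mod 3 = 1 \<or> x mod 3 = 2))
      \<and> \<Sum>S = n
      \<and> card {x\<in>S. x mod 3 = 1} = u
      \<and> card {x\<in>S. x mod 3 = 2} = v}"

text \<open>A coloured part is a pair (value, primed).  A two-coloured partition is written as the
  list [lambda_1, ..., lambda_s] of its parts.\<close>

definition chi :: "nat \<times> bool \<Rightarrow> nat" where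
  "chi p = (if snd p then 1 else 0)"

definition gap_ok :: "nat \<times> bool \<Rightarrow> nat \<times> bool \<Rightarrow> bool" where
  "gap_ok p q =
     ((fst p mod 6 \<in> {1,2,3,5} \<and> \<not> snd p \<longrightarrow> fst q + 4 + chi q \<le> fst p) \<and>
      (fst p mod 6 \<in> {0,4} \<longrightarrow> fst q + 5 + chi q \<le> fst p) \<and>
      (fst p mod 6 \<in> {1,5} \<and> snd p \<longrightarrow> fst q + 6 + chi q \<le> fst p))"

definition D3_partition :: "nat \<Rightarrow> nat \<Rightarrow> nat \<Rightarrow> (nat \<times> bool) list \<Rightarrow> bool" where
  "D3_partition u v n ps \<longleftrightarrow>
     (\<forall>p\<in>set ps. 0 < fst p) \<and>
     (\<forall>p\<in>set ps. snd p \<longrightarrow> fst p mod 6 = 1 \<or> fst p mod 6 = 5) \<and>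
     (1, True) \<notin> set ps \<and>
     sorted_wrt (\<lambda>p q. fst q \<le> fst p) ps \<and>
     sum_list (map fst ps) = n \<and>
     u = length (filter (\<lambda>p. \<not> snd p \<and> (fst p mod 3 = 0 \<or> fst p mod 3 = 1)) ps)
         + 2 * length (filter (\<lambda>p. snd p \<and> fst p mod 6 = 5) ps) \<and>
     v = length (filter (\<lambda>p. \<not> snd p \<and> (fst p mod 3 = 0 \<or> fst p mod 3 = 2)) ps)
         + 2 * length (filter (\<lambda>p. snd p \<and> fst p mod 6 = 1) ps) \<and>
     (\<forall>i. i + 1 < length ps \<longrightarrow> gap_ok (ps ! i) (ps ! (i + 1)))"

definition D3 :: "nat \<Rightarrow> nat \<Rightarrow> nat \<Rightarrow> nat" where
  "D3 u v n = card {ps. D3_partition u v n ps}"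

end

theory Submission
  imports Defs "HOL-Computational_Algebra.Polynomial"
begin

text \<open>
  Let $P_m(x,y)$ be the generating polynomial of the coloured partitions all of whose parts $p$
  satisfy $p + \chi(p) \le m$, where $x$, $y$, $q$ mark $u$, $v$, $n$. Sorting by the largest part
  gives a six-periodic recurrence for $P_m$. From it one proves by induction that
  $P_{6k+6}(x,y) = (1 + xq)\, P_{6k+4}(yq, xq^2)$, which becomes, as $k$ grows, the
  functional equation $P(x,y) = (1 + xq)\, P(yq, xq^2)$. The sets counted by $C_3$ satisfy the same
  equation: $1$ either is a part or not, and $x \mapsto$ the next non-multiple of $3$ shifts the
  remaining parts while exchanging the two residue classes. The functional equation determines
  all coefficients.
\<close>

section \<open>Coloured partitions as bounded lists\<close>

text \<open>With \<open>chi\<close> split off, the required difference depends on the larger part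
  alone, so a gap condition is an upper bound for \<open>fst q + chi q\<close>.\<close>

definition part_gap :: "nat \<times> bool \<Rightarrow> nat" where
  "part_gap p = (if snd p then 6 else if fst p mod 6 = 0 \<or> fst p mod 6 = 4 then 5 else 4)"

definition admissible_part :: "nat \<times> bool \<Rightarrow> bool" where
  "admissible_part p \<longleftrightarrow> 0 < fst p \<and> (snd p \<longrightarrow> fst p \<noteq> 1 \<and> (fst p mod 6 = 1 \<or> fst p mod 6 = 5))"

text \<open>
  The parameter \<open>m\<close> bounds \<open>fst p + chi p\<close> rather than \<open>fst p\<close>, since the gap conditions bound
  exactly this quantity for the next part. When \<open>fst p < part_gap p\<close> the truncated
  difference is 0, and then no further part is possible.
\<close>

fun admissible :: "nat \<Rightarrow> (nat \<times> bool) list \<Rightarrow> bool" where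
  "admissible m [] = True"
| "admissible m (p # ps) \<longleftrightarrow>
     admissible_part p \<and> fst p + chi p \<le> m \<and> admissible (fst p - part_gap p) ps"

text \<open>u and v are additive over the parts, so prepending a part multiplies the weight of a
  list by a monomial. Unprimed multiples of 3 count in both.\<close>

definition part_u :: "nat \<times> bool \<Rightarrow> nat" where
  "part_u p = (if snd p then (if fst p mod 6 = 5 then 2 else 0) else if fst p mod 3 = 2 then 0 else 1)"

definition part_v :: "nat \<times> bool \<Rightarrow> nat" where
  "part_v p = (if snd p then (if fst p mod 6 = 1 then 2 else 0) else if fst p mod 3 = 1 then 0 else 1)"

abbreviation list_u :: "(nat \<times> bool) list \<Rightarrow> nat" where
  "list_u ps \<equiv> sum_list (map part_u ps)"

abbreviation list_v :: "(nat \<times> bool) list \<Rightarrow> nat" where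
  "list_v ps \<equiv> sum_list (map part_v ps)"

abbreviation list_n :: "(nat \<times> bool) list \<Rightarrow> nat" where
  "list_n ps \<equiv> sum_list (map fst ps)"

lemma list_u_eq:
  "list_u ps = length (filter (\<lambda>p. \<not> snd p \<and> (fst p mod 3 = 0 \<or> fst p mod 3 = 1)) ps)
     + 2 * length (filter (\<lambda>p. snd p \<and> fst p mod 6 = 5) ps)"
proof (induction ps)
  case (Cons p ps)
  have "fst p mod 3 = 0 \<or> fst p mod 3 = 1 \<or> fst p mod 3 = 2"
    by presburger
  with Cons show ?case
    by (auto simp: part_u_def)
qed simp

lemma list_v_eq:
  "list_v ps = length (filter (\<lambda>p. \<not> snd p \<and> (fst p mod 3 = 0 \<or> fst p mod 3 = 2)) ps)
     + 2 * length (filter (\<lambda>p. snd p \<and> fst p mod 6 = 1) ps)"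
proof (induction ps)
  case (Cons p ps)
  have "fst p mod 3 = 0 \<or> fst p mod 3 = 1 \<or> fst p mod 3 = 2"
    by presburger
  with Cons show ?case
    by (auto simp: part_v_def)
qed simp

text \<open>Truncated subtraction does no harm: if \<open>fst p < part_gap p\<close>, the bound is 0
  and \<open>0 < fst q\<close> makes both sides false.\<close>

lemma gap_ok_iff:
  assumes "admissible_part p" "admissible_part q"
  shows "gap_ok p q \<longleftrightarrow> fst q + chi q \<le> fst p - part_gap p"
proof -
  have "fst p mod 6 \<in> {0,1,2,3,4,5}"
    by (simp, presburger)
  moreover have "0 < fst q"
    using assms by (simp add: admissible_part_def)
  ultimately show ?thesis
    using assms(1) unfolding gap_ok_def part_gap_def admissible_part_def
    by auto
qed

lemma admissible_le: "admissible m ps \<Longrightarrow> p \<in> set ps \<Longrightarrow> fst p \<le> m"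
proof (induction m ps rule: admissible.induct)
  case (2 m p' ps)
  then show ?case by fastforce
qed simp

lemma admissible_sorted: "admissible m ps \<Longrightarrow> sorted_wrt (\<lambda>p q. fst q \<le> fst p) ps"
proof (induction m ps rule: admissible.induct)
  case (2 m p ps)
  then show ?case
    using admissible_le[of "fst p - part_gap p" ps] by fastforce
qed simp

text \<open>Each recursive call bounds the next head, and by \<open>gap_ok_iff\<close> that bound is
  the gap condition; only the first part is compared with \<open>m\<close> itself.\<close>

lemma admissible_iff:
  "admissible m ps \<longleftrightarrow> (\<forall>p\<in>set ps. admissible_part p) \<and> (ps \<noteq> [] \<longrightarrow> fst (hd ps) + chi (hd ps) \<le> m)
     \<and> (\<forall>i. i + 1 < length ps \<longrightarrow> gap_ok (ps ! i) (ps ! (i + 1)))"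
proof (induction m ps rule: admissible.induct)
  case (2 m p ps)
  have gaps: "(\<forall>i. i + 1 < length (p # ps) \<longrightarrow> gap_ok ((p # ps) ! i) ((p # ps) ! (i + 1)))
     \<longleftrightarrow> (ps \<noteq> [] \<longrightarrow> gap_ok p (hd ps)) \<and> (\<forall>i. i + 1 < length ps \<longrightarrow> gap_ok (ps ! i) (ps ! (i + 1)))"
    (is "?L \<longleftrightarrow> ?R1 \<and> ?R2")
  proof (intro iffI conjI)
    assume L: ?L
    show ?R1 using L[rule_format, of 0] by (auto simp: hd_conv_nth)
    show ?R2
    proof (intro allI impI)
      fix i assume "i + 1 < length ps"
      then show "gap_ok (ps ! i) (ps ! (i + 1))"
        using L[rule_format, of "Suc i"] by simp
    qed
  next
    assume R: "?R1 \<and> ?R2"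
    show ?L
    proof (intro allI impI)
      fix i assume "i + 1 < length (p # ps)"
      then show "gap_ok ((p # ps) ! i) ((p # ps) ! (i + 1))"
        using R by (cases i) (auto simp: hd_conv_nth)
    qed
  qed
  show ?case
    unfolding gaps using "2.IH" by (auto simp: gap_ok_iff)
qed simp

text \<open>A part is at most n and \<open>chi\<close> adds at most 1, so \<open>n < m\<close> makes
  the bound on the first part automatic. The gaps also force the ordering.\<close>

lemma D3_partition_iff:
  assumes "n < m"
  shows "D3_partition u v n ps \<longleftrightarrow> admissible m ps \<and> list_u ps = u \<and> list_v ps = v \<and> list_n ps = n"
proof -
  have parts: "(\<forall>p\<in>set ps. admissible_part p) \<longleftrightarrow> (\<forall>p\<in>set ps. 0 < fst p) \<and>
     (\<forall>p\<in>set ps. snd p \<longrightarrow> fst p mod 6 = 1 \<or> fst p mod 6 = 5) \<and> (1, True) \<notin> set ps"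
    unfolding admissible_part_def by (force simp: prod_eq_iff)
  have "fst (hd ps) + chi (hd ps) \<le> m" if "ps \<noteq> []" "list_n ps = n"
    using that assms by (cases ps) (auto simp: chi_def)
  then have adm: "admissible m ps \<longleftrightarrow> (\<forall>p\<in>set ps. admissible_part p)
      \<and> (\<forall>i. i + 1 < length ps \<longrightarrow> gap_ok (ps ! i) (ps ! (i + 1)))" if "list_n ps = n"
    using that unfolding admissible_iff by blast
  show ?thesis
  proof (cases "list_n ps = n")
    case True
    have "sorted_wrt (\<lambda>p q. fst q \<le> fst p) ps" if "\<forall>p\<in>set ps. admissible_part p"
      "\<forall>i. i + 1 < length ps \<longrightarrow> gap_ok (ps ! i) (ps ! (i + 1))"
      using admissible_sorted[of m ps] adm[OF True] that by blast
    then show ?thesis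
      unfolding D3_partition_def list_u_eq list_v_eq adm[OF True]
      using parts True by argo
  qed (simp add: D3_partition_def)
qed

lemma admissible_0: "{ps. admissible 0 ps} = {[]}"
proof -
  have "ps = []" if "admissible 0 ps" for ps
    using that by (cases ps) (auto simp: admissible_part_def)
  then show ?thesis by auto
qed

text \<open>A head new at \<open>Suc m\<close> has \<open>fst p + chi p = Suc m\<close>: it is
  \<open>Suc m\<close> unprimed, always admissible, or \<open>m\<close> primed, whose
  \<open>part_gap\<close> is 6.\<close>

lemma admissible_Suc:
  "{ps. admissible (Suc m) ps} = {ps. admissible m ps}
     \<union> (#) (Suc m, False) ` {ps. admissible (Suc m - part_gap (Suc m, False)) ps}
     \<union> (if admissible_part (m, True) then (#) (m, True) ` {ps. admissible (m - 6) ps} else {})"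
    (is "?L = ?R")
proof (rule set_eqI)
  fix ps
  show "ps \<in> ?L \<longleftrightarrow> ps \<in> ?R"
  proof (cases ps)
    case (Cons p qs)
    obtain a b where p: "p = (a, b)" by fastforce
    have unprimed: "admissible_part (a, False) \<longleftrightarrow> 0 < a" for a
      by (simp add: admissible_part_def)
    show ?thesis
      unfolding Cons p
      by (cases b) (auto simp: chi_def le_Suc_eq unprimed part_gap_def)
  qed simp
qed

lemma finite_admissible: "finite {ps. admissible m ps}"
proof (induction m rule: less_induct)
  case (less m)
  show ?case
  proof (cases m)
    case 0
    then show ?thesis by (simp add: admissible_0)
  next
    case (Suc k)
    have "Suc k - part_gap (Suc k, False) < m" "k - 6 < m" "k < m"
      using Suc by (auto simp: part_gap_def)
    then have "finite {ps. admissible (Suc k - part_gap (Suc k, False)) ps}"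
      "finite {ps. admissible (k - 6) ps}" "finite {ps. admissible k ps}"
      by (blast intro: less.IH)+
    then show ?thesis
      unfolding Suc admissible_Suc by simp
  qed
qed

section \<open>Generating polynomials and their recurrence\<close>

text \<open>With x, y, q in an arbitrary commutative ring, the substitution (yq, xq^2) is a mere
  change of arguments.\<close>

definition admissible_gf :: "'a::comm_ring_1 \<Rightarrow> 'a \<Rightarrow> 'a \<Rightarrow> nat \<Rightarrow> 'a" where
  "admissible_gf q x y m = (\<Sum>ps | admissible m ps. x ^ list_u ps * y ^ list_v ps * q ^ list_n ps)"

lemma admissible_gf_0: "admissible_gf q x y 0 = 1"
  by (simp add: admissible_gf_def admissible_0)

lemma admissible_gf_Suc:
  fixes q x y :: "'a::comm_ring_1"
  defines "P \<equiv> admissible_gf q x y"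
  defines "w \<equiv> \<lambda>p. x ^ part_u p * y ^ part_v p * q ^ fst p"
  shows "P (Suc m) = P m + w (Suc m, False) * P (Suc m - part_gap (Suc m, False))
     + (if admissible_part (m, True) then w (m, True) * P (m - 6) else 0)"
proof -
  let ?A = "\<lambda>m. {ps. admissible m ps}"
  let ?t = "\<lambda>ps. x ^ list_u ps * y ^ list_v ps * q ^ list_n ps"
  have cons: "sum ?t ((#) p ` ?A k) = w p * P k" for p k
    by (subst sum.reindex)
       (auto simp: w_def P_def admissible_gf_def sum_distrib_left power_add algebra_simps)
  let ?U = "(#) (Suc m, False) ` ?A (Suc m - part_gap (Suc m, False))"
  let ?V = "if admissible_part (m, True) then (#) (m, True) ` ?A (m - 6) else {}"
  have disj: "?A m \<inter> ?U = {}" "(?A m \<union> ?U) \<inter> ?V = {}"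
    by (auto simp: chi_def)
  have "P (Suc m) = sum ?t (?A m \<union> ?U \<union> ?V)"
    unfolding P_def admissible_gf_def admissible_Suc ..
  also have "\<dots> = sum ?t (?A m \<union> ?U) + sum ?t ?V"
    by (rule sum.union_disjoint) (use disj finite_admissible in auto)
  also have "sum ?t (?A m \<union> ?U) = sum ?t (?A m) + sum ?t ?U"
    by (rule sum.union_disjoint) (use disj finite_admissible in auto)
  finally show ?thesis
    using cons by (simp add: P_def admissible_gf_def)
qed

text \<open>The indices are separate variables so that applying a rule leaves only arithmetic. Since
  1' is not a part, a = 1 lacks the primed term of its residue class; hence the last
  equation.\<close>

lemma admissible_gf_step:
  fixes q x y :: "'a::comm_ring_1"
  defines "P \<equiv> admissible_gf q x y"
  shows "a mod 6 = 0 \<Longrightarrow> b = a + 1 \<Longrightarrow> c = b - 4 \<Longrightarrow> P b = P a + x * q^b * P c"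
    and "a mod 6 = 1 \<Longrightarrow> a \<noteq> 1 \<Longrightarrow> b = a + 1 \<Longrightarrow> c = b - 4 \<Longrightarrow> d = a - 6 \<Longrightarrow>
           P b = P a + y * q^b * P c + y^2 * q^a * P d"
    and "a mod 6 = 2 \<Longrightarrow> b = a + 1 \<Longrightarrow> c = b - 4 \<Longrightarrow> P b = P a + x * y * q^b * P c"
    and "a mod 6 = 3 \<Longrightarrow> b = a + 1 \<Longrightarrow> c = b - 5 \<Longrightarrow> P b = P a + x * q^b * P c"
    and "a mod 6 = 4 \<Longrightarrow> b = a + 1 \<Longrightarrow> c = b - 4 \<Longrightarrow> P b = P a + y * q^b * P c"
    and "a mod 6 = 5 \<Longrightarrow> b = a + 1 \<Longrightarrow> c = b - 5 \<Longrightarrow> d = a - 6 \<Longrightarrow>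
           P b = P a + x * y * q^b * P c + x^2 * q^a * P d"
    and "P 2 = P 1 + y * q^2"
proof -
  note S = admissible_gf_Suc[of q x y a, folded P_def]
  note defs = part_gap_def part_u_def part_v_def admissible_part_def
  {
    assume "a mod 6 = 0"
    moreover from this have "Suc a mod 6 = 1" "Suc a mod 3 = 1" by presburger+
    moreover assume "b = a + 1" "c = b - 4"
    ultimately show "P b = P a + x * q^b * P c"
      using S by (simp add: defs)
  next
    assume "a mod 6 = 1" "a \<noteq> 1"
    moreover from this have "Suc a mod 6 = 2" "Suc a mod 3 = 2" "a > 0" by presburger+
    moreover assume "b = a + 1" "c = b - 4" "d = a - 6"
    ultimately show "P b = P a + y * q^b * P c + y^2 * q^a * P d"
      using S by (simp add: defs)
  next
    assume "a mod 6 = 2"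
    moreover from this have "Suc a mod 6 = 3" "Suc a mod 3 = 0" by presburger+
    moreover assume "b = a + 1" "c = b - 4"
    ultimately show "P b = P a + x * y * q^b * P c"
      using S by (simp add: defs)
  next
    assume "a mod 6 = 3"
    moreover from this have "Suc a mod 6 = 4" "Suc a mod 3 = 1" by presburger+
    moreover assume "b = a + 1" "c = b - 5"
    ultimately show "P b = P a + x * q^b * P c"
      using S by (simp add: defs)
  next
    assume "a mod 6 = 4"
    moreover from this have "Suc a mod 6 = 5" "Suc a mod 3 = 2" by presburger+
    moreover assume "b = a + 1" "c = b - 4"
    ultimately show "P b = P a + y * q^b * P c"
      using S by (simp add: defs)
  next
    assume "a mod 6 = 5"
    moreover from this have "Suc a mod 6 = 0" "Suc a mod 3 = 0" "a > 0" "a \<noteq> 1" by presburger+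
    moreover assume "b = a + 1" "c = b - 5" "d = a - 6"
    ultimately show "P b = P a + x * y * q^b * P c + x^2 * q^a * P d"
      using S by (simp add: defs)
  }
  show "P 2 = P 1 + y * q^2"
    using admissible_gf_Suc[of q x y 1, folded P_def]
    by (simp add: defs P_def admissible_gf_0 numeral_2_eq_2)
qed

lemma admissible_gf_initial:
  fixes q x y :: "'a::comm_ring_1"
  defines "P \<equiv> admissible_gf q x y"
  shows "P 1 = 1 + x * q" and "P 2 = P 1 + y * q^2" and "P 3 = P 2 + x * y * q^3"
  using admissible_gf_step(1)[of 0 1 0 q x y] admissible_gf_step(3)[of 2 3 0 q x y]
    admissible_gf_step(7)[of q x y]
  by (simp_all add: P_def admissible_gf_0)

text \<open>Nine consecutive steps with q^(6k) factored out, so that the remaining exponents are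
  fixed. At k = 0 the truncation \<open>6*k-1 = 0\<close> supplies the value 1 that the index -1
  calls for.\<close>

lemma admissible_gf_rec:
  fixes q x y :: "'a::comm_ring_1" and k :: nat
  defines "P \<equiv> admissible_gf q x y"
  defines "z \<equiv> q ^ (6*k)"
  shows "P (6*k+4) = P (6*k+3) + x * (q^4*z) * P (6*k-1)"
    and "P (6*k+5) = P (6*k+4) + y * (q^5*z) * P (6*k+1)"
    and "P (6*k+6) = P (6*k+5) + x*y * (q^6*z) * P (6*k+1) + x^2 * (q^5*z) * P (6*k-1)"
    and "P (6*k+7) = P (6*k+6) + x * (q^7*z) * P (6*k+3)"
    and "P (6*k+8) = P (6*k+7) + y * (q^8*z) * P (6*k+4) + y^2 * (q^7*z) * P (6*k+1)"
    and "P (6*k+9) = P (6*k+8) + x*y * (q^9*z) * P (6*k+5)"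
    and "P (6*k+10) = P (6*k+9) + x * (q^10*z) * P (6*k+5)"
    and "P (6*k+11) = P (6*k+10) + y * (q^11*z) * P (6*k+7)"
    and "P (6*k+12) = P (6*k+11) + x*y * (q^12*z) * P (6*k+7) + x^2 * (q^11*z) * P (6*k+5)"
proof -
  have pw: "q^i * z = q^(6*k+i)" for i
    by (simp add: z_def power_add mult.commute)
  show "P (6*k+4) = P (6*k+3) + x * (q^4*z) * P (6*k-1)"
    "P (6*k+5) = P (6*k+4) + y * (q^5*z) * P (6*k+1)"
    "P (6*k+6) = P (6*k+5) + x*y * (q^6*z) * P (6*k+1) + x^2 * (q^5*z) * P (6*k-1)"
    "P (6*k+7) = P (6*k+6) + x * (q^7*z) * P (6*k+3)"
    "P (6*k+8) = P (6*k+7) + y * (q^8*z) * P (6*k+4) + y^2 * (q^7*z) * P (6*k+1)"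
    "P (6*k+9) = P (6*k+8) + x*y * (q^9*z) * P (6*k+5)"
    "P (6*k+10) = P (6*k+9) + x * (q^10*z) * P (6*k+5)"
    "P (6*k+11) = P (6*k+10) + y * (q^11*z) * P (6*k+7)"
    "P (6*k+12) = P (6*k+11) + x*y * (q^12*z) * P (6*k+7) + x^2 * (q^11*z) * P (6*k+5)"
    unfolding P_def pw by (rule admissible_gf_step; presburger)+
qed

section \<open>The shift identity\<close>

text \<open>
  Only the third equation is the goal; the other three are what is needed for the induction to close.
\<close>

lemma admissible_gf_shift:
  fixes q x y :: "'a::comm_ring_1"
  defines "P \<equiv> admissible_gf q x y"
  defines "Q \<equiv> admissible_gf q (y * q) (x * q^2)"
  shows "P (6*k+1) = (1 + x*q) * Q (6*k-1) \<and> P (6*k+3) = (1 + x*q) * Q (6*k+1)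
     \<and> P (6*k+6) = (1 + x*q) * Q (6*k+4) \<and> P (6*k+5) = Q (6*k+4) + x*q * Q (6*k+1)"
proof (induction k)
  case 0
  have "P 0 = 1" "Q 0 = 1" by (simp_all add: P_def Q_def admissible_gf_0)
  then show ?case
    using admissible_gf_rec[of q x y 0, folded P_def, simplified]
      admissible_gf_rec[of q "y*q" "x*q^2" 0, folded Q_def, simplified]
      admissible_gf_initial[of q x y, folded P_def]
      admissible_gf_initial[of q "y*q" "x*q^2", folded Q_def]
    by (simp add: algebra_simps power2_eq_square eval_nat_numeral)
next
  case (Suc k)
  \<comment> \<open>Naming the values turns the induction step into ring identities in finitely many
    unknowns.\<close>
  define z where "z = q ^ (6*k)"
  define P1 P3 P4 P5 P6 P7 P8 P9 P10 P11 P12 where P_defs: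
    "P1 = P (6*k+1)" "P3 = P (6*k+3)" "P4 = P (6*k+4)" "P5 = P (6*k+5)" "P6 = P (6*k+6)"
    "P7 = P (6*k+7)" "P8 = P (6*k+8)" "P9 = P (6*k+9)" "P10 = P (6*k+10)" "P11 = P (6*k+11)"
    "P12 = P (6*k+12)"
  define Q0 Q1 Q3 Q4 Q5 Q6 Q7 Q8 Q9 Q10 Q11 Q12 where Q_defs:
    "Q0 = Q (6*k-1)"
    "Q1 = Q (6*k+1)" "Q3 = Q (6*k+3)" "Q4 = Q (6*k+4)" "Q5 = Q (6*k+5)" "Q6 = Q (6*k+6)"
    "Q7 = Q (6*k+7)" "Q8 = Q (6*k+8)" "Q9 = Q (6*k+9)" "Q10 = Q (6*k+10)" "Q11 = Q (6*k+11)"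
    "Q12 = Q (6*k+12)"
  have IH: "P1 = (1 + x*q) * Q0" "P3 = (1 + x*q) * Q1" "P6 = (1 + x*q) * Q4" "P5 = Q4 + x*q * Q1"
    using Suc.IH by (simp_all only: P_defs Q_defs)
  note recP = admissible_gf_rec[of q x y k, folded P_def z_def, folded P_defs]
  note recQ = admissible_gf_rec[of q "y*q" "x*q^2" k, folded Q_def z_def, folded Q_defs]
  \<comment> \<open>\<open>C\<close>, \<open>B\<close>, \<open>A\<close>, \<open>D\<close> are the
    first, second, third and fourth equations for \<open>Suc k\<close>.\<close>
  have C: "P7 = (1 + x*q) * Q5"
    unfolding recP(4) recQ(2) IH by (simp add: algebra_simps eval_nat_numeral)
  \<comment> \<open>The hypothesis says nothing about P4 and Q3. Solving the next recurrence for
    each leaves only Q0, Q1, Q4, Q5 in the identity for \<open>B\<close>.\<close>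
  have P4: "P4 = Q4 + x*q * Q1 - y * (q^5*z) * ((1 + x*q) * Q0)"
    using recP(2) unfolding IH by (simp add: algebra_simps)
  have Q3: "Q3 = Q4 - y*q * (q^4*z) * Q0"
    using recQ(1) by (simp add: algebra_simps)
  have B: "P9 = (1 + x*q) * Q7"
    unfolding recP(6) recP(5) P4 C IH recQ(4) recQ(3) Q3
    by (simp add: algebra_simps eval_nat_numeral)
  \<comment> \<open>The terms added between P9 and P12 pair up: xq^10 z + x^2 q^11 z and yq^11 z +
    xyq^12 z both contain 1 + xq, the factor missing from P5.\<close>
  have A: "P12 = (1 + x*q) * Q10"
    unfolding recP(9) recP(8) recP(7) B C IH recQ(7) recQ(6) recQ(5)
    by (simp add: algebra_simps eval_nat_numeral)
  have "P11 = P12 - x*y * (q^12*z) * P7 - x^2 * (q^11*z) * P5"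
    using recP(9) by (simp add: algebra_simps)
  then have D: "P11 = Q10 + x*q * Q7"
    unfolding A C IH recQ(7) recQ(6) recQ(5) by (simp add: algebra_simps eval_nat_numeral)
  have "6 * Suc k + 1 = 6*k+7" "6 * Suc k - 1 = 6*k+5" "6 * Suc k + 3 = 6*k+9"
    "6 * Suc k + 6 = 6*k+12" "6 * Suc k + 4 = 6*k+10" "6 * Suc k + 5 = 6*k+11" by simp_all
  then show ?case
    using A B C D by (simp only: P_defs Q_defs simp_thms)
qed

section \<open>From polynomials to a recurrence for \<open>D3\<close>\<close>

text \<open>The monomial x^u y^v q^n in Z[q][y][x], with x outermost. Integer coefficients provide
  the ring that \<open>admissible_gf\<close> requires.\<close>

definition monom3 :: "nat \<Rightarrow> nat \<Rightarrow> nat \<Rightarrow> int poly poly poly" where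
  "monom3 u v n = monom (monom (monom 1 n) v) u"

lemma monom3_mult: "monom3 u v n * monom3 u' v' n' = monom3 (u + u') (v + v') (n + n')"
  by (simp add: monom3_def mult_monom)

lemma monom3_0: "monom3 0 0 0 = 1"
  by (simp add: monom3_def)

lemma monom3_power: "monom3 u v n ^ k = monom3 (k * u) (k * v) (k * n)"
  by (induction k) (simp_all add: monom3_0 monom3_mult)

lemma coeff_monom3:
  "coeff (coeff (coeff (monom3 u v n) u') v') n' = (if u = u' \<and> v = v' \<and> n = n' then 1 else 0)"
  by (simp add: monom3_def)

lemma coeff_sum_monom3:
  assumes "finite A"
  shows "coeff (coeff (coeff (\<Sum>a\<in>A. monom3 (f a) (g a) (h a)) u) v) n
     = int (card {a\<in>A. f a = u \<and> g a = v \<and> h a = n})"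
proof -
  have "coeff (coeff (coeff (\<Sum>a\<in>A. monom3 (f a) (g a) (h a)) u) v) n
     = (\<Sum>a\<in>A. if f a = u \<and> g a = v \<and> h a = n then 1 else 0)"
    by (simp add: coeff_sum coeff_monom3)
  also have "\<dots> = int (card {a\<in>A. f a = u \<and> g a = v \<and> h a = n})"
    using assms by (simp add: sum.If_cases Int_def)
  finally show ?thesis .
qed

text \<open>Every bound above n gives the same coefficient, so a suitable finite k takes the place
  of a limit.\<close>

lemma card_admissible:
  assumes "n < m"
  shows "card {ps \<in> {ps. admissible m ps}. list_u ps = u \<and> list_v ps = v \<and> list_n ps = n} = D3 u v n"
  unfolding D3_def D3_partition_iff[OF assms] by simp

text \<open>
  The coefficient of $x^u y^v q^n$ in $F(yq, xq^2)$: the substitution turns $x^v y^u q^m$ into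
  $x^u y^v q^{m+v+2u}$.
\<close>

definition shift_count :: "(nat \<Rightarrow> nat \<Rightarrow> nat \<Rightarrow> nat) \<Rightarrow> nat \<Rightarrow> nat \<Rightarrow> nat \<Rightarrow> nat" where
  "shift_count F u v n = (if v + 2 * u \<le> n then F v u (n - (v + 2 * u)) else 0)"

text \<open>The shift identity at k = n: both bounds, 6n+6 and 6n+4, exceed n, so the coefficients
  are full counts. The summands 1 and xq give the two terms.\<close>

lemma D3_rec:
  "D3 u v n = shift_count D3 u v n + (if 1 \<le> u \<and> 1 \<le> n then shift_count D3 (u - 1) v (n - 1) else 0)"
proof -
  define x y q where "x = monom3 1 0 0" and "y = monom3 0 1 0" and "q = monom3 0 0 1"
  note xyq = x_def y_def q_def
  let ?c = "\<lambda>p. coeff (coeff (coeff p u) v) n"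
  let ?A = "{ps. admissible (6*n+4) ps}"
  have "admissible_gf q x y (6*n+6)
      = (\<Sum>ps | admissible (6*n+6) ps. monom3 (list_u ps) (list_v ps) (list_n ps))"
    unfolding admissible_gf_def xyq by (simp add: monom3_power monom3_mult)
  then have "int (D3 u v n) = ?c (admissible_gf q x y (6*n+6))"
    using card_admissible[of n "6*n+6" u v] by (simp only: coeff_sum_monom3[OF finite_admissible])
  also have "admissible_gf q x y (6*n+6)
      = (1 + x*q) * admissible_gf q (y * q) (x * q^2) (6*n+4)"
    using admissible_gf_shift by blast
  \<comment> \<open>The \<open>list_u\<close> factors yq and \<open>list_v\<close> factors xq^2 make
    u and v trade places and add u + 2v to the exponent of q.\<close>
  also have "admissible_gf q (y * q) (x * q^2) (6*n+4)
      = (\<Sum>ps\<in>?A. monom3 (list_v ps) (list_u ps) (list_n ps + list_u ps + 2 * list_v ps))"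
    (is "_ = ?S")
    unfolding admissible_gf_def xyq
    by (simp add: monom3_power monom3_mult power_mult_distrib mult_2 ac_simps)
  also have "(1 + x*q) * ?S = ?S +
      (\<Sum>ps\<in>?A. monom3 (list_v ps + 1) (list_u ps) (list_n ps + list_u ps + 2 * list_v ps + 1))"
    unfolding xyq by (simp add: monom3_mult distrib_right sum_distrib_left sum.distrib)
  finally have "int (D3 u v n) =
      int (card {ps\<in>?A. list_v ps = u \<and> list_u ps = v \<and> list_n ps + list_u ps + 2 * list_v ps = n})
      + int (card {ps\<in>?A. list_v ps + 1 = u \<and> list_u ps = v \<and> list_n ps + list_u ps + 2 * list_v ps + 1 = n})"
    by (simp only: coeff_add coeff_sum_monom3[OF finite_admissible])
  moreover have shift: "card {ps\<in>?A. list_v ps = u' \<and> list_u ps = v' \<and> list_n ps + list_u ps + 2 * list_v ps = n'}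
      = shift_count D3 u' v' n'" if "n' \<le> n" for u' v' n'
  proof (cases "v' + 2 * u' \<le> n'")
    case True
    then have "{ps\<in>?A. list_v ps = u' \<and> list_u ps = v' \<and> list_n ps + list_u ps + 2 * list_v ps = n'}
      = {ps\<in>?A. list_u ps = v' \<and> list_v ps = u' \<and> list_n ps = n' - (v' + 2 * u')}"
      by auto
    then show ?thesis
      using True that card_admissible[of "n' - (v' + 2 * u')" "6*n+4" v' u']
      by (simp add: shift_count_def)
  next
    case False
    then have "{ps\<in>?A. list_v ps = u' \<and> list_u ps = v' \<and> list_n ps + list_u ps + 2 * list_v ps = n'} = {}"
      by auto
    with False show ?thesis
      by (simp only: shift_count_def card.empty if_False)
  qed
  moreover have "card {ps\<in>?A. list_v ps + 1 = u \<and> list_u ps = v \<and> list_n ps + list_u ps + 2 * list_v ps + 1 = n}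
      = (if 1 \<le> u \<and> 1 \<le> n then shift_count D3 (u - 1) v (n - 1) else 0)"
  proof (cases "1 \<le> u \<and> 1 \<le> n")
    case True
    then have "{ps\<in>?A. list_v ps + 1 = u \<and> list_u ps = v \<and> list_n ps + list_u ps + 2 * list_v ps + 1 = n}
      = {ps\<in>?A. list_v ps = u - 1 \<and> list_u ps = v \<and> list_n ps + list_u ps + 2 * list_v ps = n - 1}"
      by auto
    then show ?thesis
      using True shift[of "n - 1" "u - 1" v] by simp
  qed auto
  ultimately show ?thesis
    by (simp only: of_nat_add[symmetric] of_nat_eq_iff order_refl shift)
qed

text \<open>Every admissible part contributes to u or v. This is the base case because the shift v +
  2u lowers n only when u or v is positive.\<close>

lemma D3_0_0: "D3 0 0 n = (if n = 0 then 1 else 0)"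
proof -
  have pos: "part_u p + part_v p > 0" if "admissible_part p" for p
    using that by (auto simp: part_u_def part_v_def admissible_part_def)
  have "D3_partition 0 0 n ps \<longleftrightarrow> n = 0 \<and> ps = []" for ps
    using pos[of "hd ps"] unfolding D3_partition_iff[OF lessI] by (cases ps) auto
  then have "{ps. D3_partition 0 0 n ps} = (if n = 0 then {[]} else {})"
    by auto
  then show ?thesis
    by (simp add: D3_def)
qed

section \<open>The same recurrence for \<open>C3\<close>\<close>

definition nonmult3_sets :: "nat set set" where
  "nonmult3_sets = {S. finite S \<and> (\<forall>x\<in>S. 0 < x \<and> (x mod 3 = 1 \<or> x mod 3 = 2))}"

abbreviation count_mod3 :: "nat \<Rightarrow> nat set \<Rightarrow> nat" where
  "count_mod3 r S \<equiv> card {x\<in>S. x mod 3 = r}"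

lemma C3_eq:
  "C3 u v n = card {S\<in>nonmult3_sets. \<Sum>S = n \<and> count_mod3 1 S = u \<and> count_mod3 2 S = v}"
  unfolding C3_def nonmult3_sets_def by (rule arg_cong[of _ _ card]) auto

text \<open>The combinatorial form of x -> yq, y -> xq^2: a part 1 mod 3 changes class at cost 1, a
  part 2 mod 3 at cost 2.\<close>

definition next_nonmult3 :: "nat \<Rightarrow> nat" where
  "next_nonmult3 x = (if x mod 3 = 1 then x + 1 else x + 2)"

lemma inj_on_next_nonmult3: "inj_on next_nonmult3 {x. x mod 3 = 1 \<or> x mod 3 = 2}"
proof (rule inj_onI)
  fix x y
  assume "x \<in> {x. x mod 3 = 1 \<or> x mod 3 = 2}" "y \<in> {x. x mod 3 = 1 \<or> x mod 3 = 2}"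
    "next_nonmult3 x = next_nonmult3 y"
  then show "x = y"
    unfolding next_nonmult3_def mem_Collect_eq by presburger
qed

lemma next_nonmult3_image:
  assumes "T \<in> nonmult3_sets"
  defines "S \<equiv> next_nonmult3 ` T"
  shows "S \<in> nonmult3_sets" "1 \<notin> S" "count_mod3 1 S = count_mod3 2 T" "count_mod3 2 S = count_mod3 1 T"
    "\<Sum>S = \<Sum>T + count_mod3 1 T + 2 * count_mod3 2 T"
proof -
  have T: "finite T" "x \<in> T \<Longrightarrow> 0 < x \<and> (x mod 3 = 1 \<or> x mod 3 = 2)" for x
    using assms by (auto simp: nonmult3_sets_def)
  have inj: "inj_on next_nonmult3 T"
    by (rule inj_on_subset[OF inj_on_next_nonmult3]) (use T in auto)
  have r: "next_nonmult3 x mod 3 = 1 \<longleftrightarrow> x mod 3 = 2" "next_nonmult3 x mod 3 = 2 \<longleftrightarrow> x mod 3 = 1"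
    "1 < next_nonmult3 x" if "x \<in> T" for x
    using T(2)[OF that] unfolding next_nonmult3_def by (auto split: if_splits) presburger+
  show "S \<in> nonmult3_sets" "1 \<notin> S"
    using T r by (fastforce simp: S_def nonmult3_sets_def)+
  have img: "{y\<in>S. R y} = next_nonmult3 ` {x\<in>T. R (next_nonmult3 x)}" for R
    unfolding S_def by blast
  have "{x\<in>S. x mod 3 = 1} = next_nonmult3 ` {x\<in>T. x mod 3 = 2}"
    "{x\<in>S. x mod 3 = 2} = next_nonmult3 ` {x\<in>T. x mod 3 = 1}"
    unfolding img using r by blast+
  then show "count_mod3 1 S = count_mod3 2 T" "count_mod3 2 S = count_mod3 1 T"
    by (auto intro!: card_image inj_on_subset[OF inj])
  have "\<Sum>S = (\<Sum>x\<in>T. next_nonmult3 x)"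
    unfolding S_def using inj by (simp add: sum.reindex)
  \<comment> \<open>The increments are written as indicators, so that their sums become the two
    counts.\<close>
  also have "\<dots> = (\<Sum>x\<in>T. x + (if x mod 3 = 1 then 1 else 0) + 2 * (if x mod 3 = 2 then 1 else 0))"
    using T(2) by (intro sum.cong) (auto simp: next_nonmult3_def)
  also have "\<dots> = \<Sum>T + count_mod3 1 T + 2 * count_mod3 2 T"
    using T(1) by (simp add: sum.distrib sum_distrib_left[symmetric] sum.If_cases Int_def)
  finally show "\<Sum>S = \<Sum>T + count_mod3 1 T + 2 * count_mod3 2 T" .
qed

lemma next_nonmult3_image_surj:
  assumes "S \<in> nonmult3_sets" "1 \<notin> S"
  obtains T where "T \<in> nonmult3_sets" "S = next_nonmult3 ` T"
proof
  \<comment> \<open>The predecessor among the non-multiples of 3; it exists on S because 1 is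
    excluded.\<close>
  define g where "g x = (if x mod 3 = 2 then x - 1 else x - 2)" for x :: nat
  have fin: "finite S"
    using assms(1) by (simp add: nonmult3_sets_def)
  have S: "1 < x \<and> (x mod 3 = 1 \<or> x mod 3 = 2)" if "x \<in> S" for x
  proof -
    have "x \<noteq> 1" using that assms(2) by blast
    moreover have "0 < x \<and> (x mod 3 = 1 \<or> x mod 3 = 2)"
      using that assms(1) by (simp add: nonmult3_sets_def)
    ultimately show ?thesis by linarith
  qed
  have g: "0 < g x \<and> (g x mod 3 = 1 \<or> g x mod 3 = 2) \<and> next_nonmult3 (g x) = x" if "x \<in> S" for x
  proof -
    \<comment> \<open>The form 3k + 4 instead of 3k + 1 encodes x > 1, so the subtractions in
      \<open>g\<close> are exact.\<close>
    have "x = 3 * (x div 3) + 2 \<or> x = 3 * (x div 3 - 1) + 4"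
      using S[OF that] by presburger
    then obtain k where "x = 3 * k + 2 \<or> x = 3 * k + 4"
      by blast
    moreover have "(3 * k + 2) mod 3 = 2" "(3 * k + 1) mod 3 = 1" "(3 * k + 4) mod 3 = 1"
      by presburger+
    ultimately show ?thesis
      by (auto simp: g_def next_nonmult3_def)
  qed
  show "g ` S \<in> nonmult3_sets"
    using fin g by (auto simp: nonmult3_sets_def)
  show "S = next_nonmult3 ` g ` S"
    using g by (force simp: image_image)
qed

lemma card_nonmult3_sets_without_1:
  "card {S\<in>nonmult3_sets. 1 \<notin> S \<and> \<Sum>S = n \<and> count_mod3 1 S = u \<and> count_mod3 2 S = v} = shift_count C3 u v n"
    (is "card ?A = _")
proof -
  let ?B = "{T\<in>nonmult3_sets. \<Sum>T + v + 2 * u = n \<and> count_mod3 1 T = v \<and> count_mod3 2 T = u}"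
  have "?A = (`) next_nonmult3 ` ?B"
  proof (intro equalityI subsetI)
    fix S assume S: "S \<in> ?A"
    then obtain T where "T \<in> nonmult3_sets" "S = next_nonmult3 ` T"
      using next_nonmult3_image_surj by blast
    with S show "S \<in> (`) next_nonmult3 ` ?B"
      using next_nonmult3_image[of T] by auto
  next
    fix S assume "S \<in> (`) next_nonmult3 ` ?B"
    then show "S \<in> ?A"
      using next_nonmult3_image by auto
  qed
  moreover have "inj_on ((`) next_nonmult3) ?B"
    by (rule inj_on_subset[OF inj_on_image_Pow[OF inj_on_next_nonmult3]])
       (auto simp: nonmult3_sets_def)
  ultimately have "card ?A = card ?B"
    by (simp add: card_image)
  also have "?B = (if v + 2 * u \<le> n then {T\<in>nonmult3_sets. \<Sum>T = n - (v + 2 * u) \<and>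
      count_mod3 1 T = v \<and> count_mod3 2 T = u} else {})"
    by auto
  finally show ?thesis
    by (simp add: shift_count_def C3_eq)
qed

lemma insert_1_nonmult3:
  assumes "S \<in> nonmult3_sets" "1 \<notin> S"
  shows "insert 1 S \<in> nonmult3_sets" "\<Sum>(insert 1 S) = \<Sum>S + 1"
    "count_mod3 1 (insert 1 S) = count_mod3 1 S + 1" "count_mod3 2 (insert 1 S) = count_mod3 2 S"
proof -
  have fin: "finite S" using assms by (simp add: nonmult3_sets_def)
  have "{x \<in> insert 1 S. x mod 3 = 1} = insert 1 {x\<in>S. x mod 3 = 1}"
    "{x \<in> insert 1 S. x mod 3 = 2} = {x\<in>S. x mod 3 = 2}" by auto
  then show "count_mod3 1 (insert 1 S) = count_mod3 1 S + 1" "count_mod3 2 (insert 1 S) = count_mod3 2 S"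
    using fin assms(2) by simp_all
  show "insert 1 S \<in> nonmult3_sets" "\<Sum>(insert 1 S) = \<Sum>S + 1"
    using fin assms by (auto simp: nonmult3_sets_def)
qed

text \<open>Split by whether 1 is a part. If it is, removing it lowers u and n by 1; the sets
  without 1 are counted by shifting.\<close>

lemma C3_rec:
  "C3 u v n = shift_count C3 u v n + (if 1 \<le> u \<and> 1 \<le> n then shift_count C3 (u - 1) v (n - 1) else 0)"
proof -
  let ?A = "{S\<in>nonmult3_sets. \<Sum>S = n \<and> count_mod3 1 S = u \<and> count_mod3 2 S = v}"
  let ?N = "{S\<in>nonmult3_sets. 1 \<notin> S \<and> \<Sum>S = n \<and> count_mod3 1 S = u \<and> count_mod3 2 S = v}"
  let ?I = "{S\<in>nonmult3_sets. 1 \<in> S \<and> \<Sum>S = n \<and> count_mod3 1 S = u \<and> count_mod3 2 S = v}"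
  let ?B = "{S\<in>nonmult3_sets. 1 \<notin> S \<and> \<Sum>S + 1 = n \<and> count_mod3 1 S + 1 = u \<and> count_mod3 2 S = v}"
  have "?A \<subseteq> Pow {..n}"
    by (auto simp: nonmult3_sets_def intro: member_le_sum[where f = "\<lambda>x. x"])
  then have fin: "finite ?A"
    by (rule finite_subset) simp
  have fin0: "finite ?N"
    using fin by (rule rev_finite_subset) blast
  have fin1: "finite ?I"
    using fin by (rule rev_finite_subset) blast
  have "?A = ?N \<union> ?I" by auto
  then have "card ?A = card ?N + card ?I"
    using fin0 fin1 by (subst card_Un_disjoint[symmetric]) auto
  moreover have "?I = insert 1 ` ?B"
  proof (intro equalityI subsetI)
    fix S assume S: "S \<in> ?I"
    define T where "T = S - {1}"
    have T: "S = insert 1 T" "T \<in> nonmult3_sets" "1 \<notin> T"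
      using S by (auto simp: T_def nonmult3_sets_def)
    with S show "S \<in> insert 1 ` ?B"
      using insert_1_nonmult3[OF T(2,3)] by auto
  next
    fix S assume "S \<in> insert 1 ` ?B"
    then show "S \<in> ?I"
      using insert_1_nonmult3 by auto
  qed
  moreover have "inj_on (insert 1) ?B"
    by (rule inj_onI) (metis (no_types, lifting) insert_ident mem_Collect_eq)
  ultimately have "card ?A = card ?N + card ?B"
    by (simp add: card_image)
  also have "?B = (if 1 \<le> u \<and> 1 \<le> n then
      {S\<in>nonmult3_sets. 1 \<notin> S \<and> \<Sum>S = n - 1 \<and> count_mod3 1 S = u - 1 \<and> count_mod3 2 S = v} else {})"
    by auto
  finally show ?thesis
    unfolding C3_eq[symmetric] using card_nonmult3_sets_without_1 by auto
qed

lemma C3_0_0: "C3 0 0 n = (if n = 0 then 1 else 0)"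
proof -
  have empty: "S = {}" if "S \<in> nonmult3_sets" "count_mod3 1 S = 0" "count_mod3 2 S = 0" for S
    using that by (fastforce simp: nonmult3_sets_def)
  have "S \<in> nonmult3_sets \<and> \<Sum>S = n \<and> count_mod3 1 S = 0 \<and> count_mod3 2 S = 0 \<longleftrightarrow> n = 0 \<and> S = {}" for S
  proof
    assume S: "S \<in> nonmult3_sets \<and> \<Sum>S = n \<and> count_mod3 1 S = 0 \<and> count_mod3 2 S = 0"
    then have "S = {}" using empty by blast
    with S show "n = 0 \<and> S = {}" by simp
  qed (simp add: nonmult3_sets_def)
  then have "{S\<in>nonmult3_sets. \<Sum>S = n \<and> count_mod3 1 S = 0 \<and> count_mod3 2 S = 0}
     = (if n = 0 then {{}} else {})"
    by simp
  then show ?thesis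
    by (simp add: C3_eq)
qed

section \<open>Comparison of the two recurrences\<close>

theorem theorem2p4:
  shows "C3 u v n = D3 u v n"
proof (induction n arbitrary: u v rule: less_induct)
  case (less n)
  show ?case
  proof (cases "u = 0 \<and> v = 0")
    case True
    then show ?thesis
      by (simp add: C3_0_0 D3_0_0)
  next
    case False
    \<comment> \<open>As u or v is positive, v + 2u > 0, so the shift strictly lowers n.\<close>
    have "shift_count C3 u v n = shift_count D3 u v n"
      using False less.IH by (auto simp: shift_count_def)
    \<comment> \<open>Here n - 1 is already smaller than n, so a shift by 0 is harmless.\<close>
    moreover have "shift_count C3 (u - 1) v (n - 1) = shift_count D3 (u - 1) v (n - 1)" if "1 \<le> n"
      using that less.IH by (auto simp: shift_count_def)
    ultimately show ?thesis
      by (subst C3_rec, subst D3_rec) auto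
  qed
qed

end
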